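(* There is an absolute constant $c>0$ and an online stopping algorithm with the following property. For every integer $n\ge 1$ and every multiset $M=\{a_1,\dots,a_n\}$ of $n$ real numbers with $\sum_{i=1}^n a_i=0$, when the algorithm is run on a uniformly random permutation of $M$ (in the game described in the context), its expected payoff is at least $c\,\mu\sqrt{n}$, where $\mu=\frac1n\sum_{i=1}^n |a_i|$ is the average absolute value of the elements of $M$. Moreover, this bound is worst-case optimal up to the constant factor: there is an absolute constant $C>0$ such that for every even $n$ and every $\mu>0$, if $M$ consists of $n/2$ copies of $\mu$ and $n/2$ copies of $-\mu$, then every online stopping algorithm has expected payoff at most $C\mu\sqrt{n}$ on a uniformly random permutation of $M$.
   Context: The game: Let $M$ be a multiset of $n$ reals summing to $0$. The player knows $n$ in advance (but not $M$). A permutation $A=(a_1,\dots,a_n)$ of $M$ is chosen uniformly at random among all $n!$ permutations (of the indexed elements). The elements $a_1,a_2,\dots$ are revealed one by one, and the player may stop the game at any time: before any element is revealed, or immediately after $a_i$ is revealed for some $i\in\{1,\dots,n\}$ (if the player never stops, the game stops automatically after $a_n$ is revealed). If the game stops right after $a_i$ is revealed (with $i=0$ meaning before anything is revealed), the player's payoff is $\sum_{j=i+1}^n a_j$, the sum of the unrevealed elements. An online stopping algorithm decides whether to stop after each revealed element based only on $n$ and the elements revealed so far. *)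

theory Defs
  imports "HOL-Probability.Probability" "HOL-Combinatorics.Permutations"
begin

text \<open>An online stopping algorithm receives the number \<open>n\<close> of elements and the list of elements
  revealed so far, and decides whether to stop now.  The algorithms are deterministic.\<close>

type_synonym stopping_algorithm = "nat \<Rightarrow> real list \<Rightarrow> bool"

text \<open>The number of revealed elements when the game stops on the order of revelation \<open>A\<close>;
  the game stops by itself once all of \<open>A\<close> is revealed.\<close>

definition stopping_time :: "stopping_algorithm \<Rightarrow> real list \<Rightarrow> nat" where
  "stopping_time S A = (LEAST i. i = length A \<or> S (length A) (take i A))"

definition payoff :: "stopping_algorithm \<Rightarrow> real list \<Rightarrow> real" where
  "payoff S A = sum_list (drop (stopping_time S A) A)"

text \<open>A multiset of \<open>n\<close> reals is given by a list \<open>M\<close> enumerating it.  The permutation is uniform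
  among all \<open>n!\<close> permutations of the positions, so equal elements count as distinguishable.\<close>

definition random_order :: "'a list \<Rightarrow> 'a list pmf" where
  "random_order M =
    map_pmf (\<lambda>p. permute_list p M) (pmf_of_set {p. p permutes {..<length M}})"

definition expected_payoff :: "stopping_algorithm \<Rightarrow> real list \<Rightarrow> real" where
  "expected_payoff S M = measure_pmf.expectation (random_order M) (payoff S)"

definition average_abs :: "real list \<Rightarrow> real" where
  "average_abs M = (\<Sum>a\<leftarrow>M. \<bar>a\<bar>) / real (length M)"

end

theory Submission
  imports Defs
begin

text \<open>Lower bound: stop after \<open>m = n div 2\<close> elements iff their sum \<open>X\<close> is negative.  Since \<open>X\<close> has
  mean \<open>0\<close>, the expected payoff is half the expectation of \<open>\<bar>X\<bar>\<close>.  The uniform order is invariant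
  under swapping the entries \<open>i\<close> and \<open>m + i\<close> for \<open>i\<close> in any \<open>T \<subseteq> {..<m}\<close>; averaging over \<open>T\<close> turns
  \<open>X\<close> into a Rademacher sum with coefficients \<open>(a\<^sub>m\<^sub>+\<^sub>i - a\<^sub>i) / 2\<close>, to which a Khintchine inequality
  applies.

  Upper bound: let \<open>R\<^sub>k\<close> be the sum of the unrevealed elements after \<open>k\<close> steps.  Given the
  past, the next element has mean \<open>R\<^sub>k / (n - k)\<close>, of the same sign as \<open>R\<^sub>k\<close>.  Hence the square of
  \<open>R\<^sub>k\<close> grows in one step by at most the square of the next element on average, and the payoff
  of every algorithm has second moment at most the sum of the squares of the elements.\<close>

section \<open>Random orders\<close>

text \<open>There are only finitely many permutations, so every real function of the order is
  integrable and expectations may be exchanged with finite sums freely.\<close>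

lemma finite_set_pmf_random_order: "finite (set_pmf (random_order M))"
  unfolding random_order_def
  by (subst set_map_pmf, subst set_pmf_of_set)
     (auto simp: finite_permutations intro!: exI[of _ id] permutes_id)

lemma integrable_random_order [simp]:
  fixes f :: "'a list \<Rightarrow> real"
  shows "integrable (measure_pmf (random_order M)) f"
  by (rule integrable_measure_pmf_finite[OF finite_set_pmf_random_order])

lemma mset_random_order: "A \<in> set_pmf (random_order M) \<Longrightarrow> mset A = mset M"
  unfolding random_order_def
  by (subst (asm) set_map_pmf, subst (asm) set_pmf_of_set)
     (auto simp: finite_permutations intro!: exI[of _ id] permutes_id)

lemma length_random_order: "A \<in> set_pmf (random_order M) \<Longrightarrow> length A = length M"
  using mset_random_order mset_eq_length by blast

lemma sum_nth_random_order:
  fixes f :: "'a \<Rightarrow> real"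
  assumes "A \<in> set_pmf (random_order M)"
  shows "(\<Sum>i<length M. f (A ! i)) = (\<Sum>a\<leftarrow>M. f a)"
proof -
  have "(\<Sum>a\<leftarrow>A. f a) = (\<Sum>a\<leftarrow>M. f a)"
    using mset_random_order[OF assms] by (metis mset_map sum_mset_sum_list)
  thus ?thesis
    using length_random_order[OF assms] by (simp add: sum_list_sum_nth atLeast0LessThan)
qed

lemma expectation_mono_random_order:
  fixes f g :: "'a list \<Rightarrow> real"
  assumes "\<And>A. A \<in> set_pmf (random_order M) \<Longrightarrow> f A \<le> g A"
  shows "measure_pmf.expectation (random_order M) f \<le> measure_pmf.expectation (random_order M) g"
  by (rule integral_mono_AE) (auto simp: AE_measure_pmf_iff assms)

lemma expectation_cong_random_order:
  fixes f g :: "'a list \<Rightarrow> real"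
  assumes "\<And>A. A \<in> set_pmf (random_order M) \<Longrightarrow> f A = g A"
  shows "measure_pmf.expectation (random_order M) f = measure_pmf.expectation (random_order M) g"
  by (rule integral_cong_AE) (auto simp: AE_measure_pmf_iff assms)

text \<open>Applying \<open>q\<close> after \<open>p\<close> to the positions gives
  \<open>p \<circ> q\<close>, and composition with a fixed \<open>q\<close> is a bijection of the
  permutations, so it preserves the uniform distribution. Every later symmetry argument is an
  instance of this.\<close>

lemma map_permute_list_random_order:
  assumes "q permutes {..<length M}"
  shows "map_pmf (permute_list q) (random_order M) = random_order M"
proof -
  let ?P = "{p. p permutes {..<length M}}"
  have fin: "finite ?P" and ne: "?P \<noteq> {}"
    by (auto simp: finite_permutations intro!: exI[of _ id] permutes_id)
  have inj: "inj_on (\<lambda>p. p \<circ> q) ?P"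
  proof (rule inj_onI)
    fix p p' assume "p \<circ> q = p' \<circ> q"
    hence "(p \<circ> q) \<circ> inv q = (p' \<circ> q) \<circ> inv q" by simp
    thus "p = p'" using permutes_inv_o(1)[OF assms] by (simp add: o_assoc [symmetric])
  qed
  have "map_pmf (\<lambda>p. p \<circ> q) (pmf_of_set ?P) = pmf_of_set ?P"
    using map_pmf_of_set_inj[OF inj ne fin] image_compose_permutations_right[OF assms]
    by (simp add: setcompr_eq_image)
  hence "map_pmf (\<lambda>p. permute_list p M) (map_pmf (\<lambda>p. p \<circ> q) (pmf_of_set ?P)) = random_order M"
    by (simp add: random_order_def)
  thus ?thesis
    by (simp add: random_order_def map_pmf_comp permute_list_compose[OF assms])
qed

lemma expectation_permute_list:
  fixes f :: "'a list \<Rightarrow> real"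
  assumes "q permutes {..<length M}"
  shows "measure_pmf.expectation (random_order M) (\<lambda>A. f (permute_list q A)) =
         measure_pmf.expectation (random_order M) f"
  by (subst (2) map_permute_list_random_order[OF assms, symmetric]) simp

lemma nth_permute_transpose:
  assumes "i < length A" "j < length A" "k < length A"
  shows "permute_list (Transposition.transpose i j) A ! k = A ! Transposition.transpose i j k"
  using assms by (auto intro!: permute_list_nth permutes_swap_id)

text \<open>Transpositions make all positions equally distributed, and the sum of \<open>f\<close>
  over all positions does not depend on the order.\<close>

lemma expectation_nth:
  fixes f :: "'a \<Rightarrow> real"
  assumes "i < length M"
  shows "measure_pmf.expectation (random_order M) (\<lambda>A. f (A ! i)) = (\<Sum>a\<leftarrow>M. f a) / length M"
proof -
  let ?E = "measure_pmf.expectation (random_order M)"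
  have eq: "?E (\<lambda>A. f (A ! j)) = ?E (\<lambda>A. f (A ! i))" if "j < length M" for j
  proof -
    have "?E (\<lambda>A. f (A ! j)) = ?E (\<lambda>A. f (permute_list (Transposition.transpose i j) A ! i))"
      using assms that
      by (intro expectation_cong_random_order) (simp add: nth_permute_transpose length_random_order)
    also have "\<dots> = ?E (\<lambda>A. f (A ! i))"
      using assms that by (intro expectation_permute_list) (auto intro: permutes_swap_id)
    finally show ?thesis .
  qed
  have "(\<Sum>a\<leftarrow>M. f a) = ?E (\<lambda>A. \<Sum>j<length M. f (A ! j))"
    using expectation_cong_random_order[of M "\<lambda>A. \<Sum>j<length M. f (A ! j)" "\<lambda>_. \<Sum>a\<leftarrow>M. f a"]
    by (simp add: sum_nth_random_order)
  also have "\<dots> = (\<Sum>j<length M. ?E (\<lambda>A. f (A ! j)))" by simp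
  also have "\<dots> = length M * ?E (\<lambda>A. f (A ! i))" by (simp add: eq)
  finally show ?thesis using assms by (auto simp: field_simps)
qed

text \<open>Since the elements sum to 0, the differences \<open>A ! i - A ! k\<close> sum over
  \<open>k\<close> to \<open>n\<close> times \<open>A ! i\<close>. The triangle inequality applies,
  and by exchangeability all terms with \<open>k \<noteq> i\<close> have the same
  expectation.\<close>

lemma expectation_abs_diff_nth:
  assumes sum0: "sum_list M = 0" and i: "i < length M" and j: "j < length M" and "i \<noteq> j"
  shows "average_abs M \<le> measure_pmf.expectation (random_order M) (\<lambda>A. \<bar>A ! i - A ! j\<bar>)"
proof -
  let ?E = "measure_pmf.expectation (random_order M)" and ?n = "length M"
  have eq: "?E (\<lambda>A. \<bar>A ! i - A ! k\<bar>) = ?E (\<lambda>A. \<bar>A ! i - A ! j\<bar>)" if "k < ?n" "k \<noteq> i" for k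
  proof -
    have "?E (\<lambda>A. \<bar>A ! i - A ! k\<bar>) =
        ?E (\<lambda>A. \<bar>permute_list (Transposition.transpose j k) A ! i - permute_list (Transposition.transpose j k) A ! j\<bar>)"
      using that i j \<open>i \<noteq> j\<close>
      by (intro expectation_cong_random_order)
         (simp add: nth_permute_transpose length_random_order Transposition.transpose_def)
    also have "\<dots> = ?E (\<lambda>A. \<bar>A ! i - A ! j\<bar>)"
      using j that
      by (intro expectation_permute_list[where f = "\<lambda>A. \<bar>A ! i - A ! j\<bar>"])
         (auto intro: permutes_swap_id)
    finally show ?thesis .
  qed
  \<comment> \<open>This covers the vanishing term \<open>k = i\<close>, so that \<open>n\<close>
    equal terms may bound the \<open>n - 1\<close> nonzero ones.\<close>
  have nonneg: "?E (\<lambda>A. \<bar>A ! i - A ! j\<bar>) \<ge> 0" by simp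
  have "?n * average_abs M = ?n * ?E (\<lambda>A. \<bar>A ! i\<bar>)"
    using expectation_nth[OF i, of abs] by (simp add: average_abs_def)
  also have "\<dots> = ?E (\<lambda>A. ?n * \<bar>A ! i\<bar>)" by simp
  also have "\<dots> \<le> ?E (\<lambda>A. \<Sum>k<?n. \<bar>A ! i - A ! k\<bar>)"
  proof (rule expectation_mono_random_order)
    fix A assume A: "A \<in> set_pmf (random_order M)"
    have "(\<Sum>k<?n. A ! i - A ! k) = ?n * A ! i"
      using sum_nth_random_order[OF A, of "\<lambda>x. x"] sum0 by (simp add: sum_subtractf)
    hence "?n * \<bar>A ! i\<bar> = \<bar>\<Sum>k<?n. A ! i - A ! k\<bar>" by (simp add: abs_mult)
    also have "\<dots> \<le> (\<Sum>k<?n. \<bar>A ! i - A ! k\<bar>)" by (rule sum_abs)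
    finally show "?n * \<bar>A ! i\<bar> \<le> (\<Sum>k<?n. \<bar>A ! i - A ! k\<bar>)" .
  qed
  also have "\<dots> = (\<Sum>k<?n. ?E (\<lambda>A. \<bar>A ! i - A ! k\<bar>))" by simp
  also have "\<dots> \<le> (\<Sum>k<?n. ?E (\<lambda>A. \<bar>A ! i - A ! j\<bar>))"
  proof (rule sum_mono)
    fix k assume "k \<in> {..<?n}"
    thus "?E (\<lambda>A. \<bar>A ! i - A ! k\<bar>) \<le> ?E (\<lambda>A. \<bar>A ! i - A ! j\<bar>)"
      using eq[of k] nonneg by (cases "k = i") auto
  qed
  also have "\<dots> = ?n * ?E (\<lambda>A. \<bar>A ! i - A ! j\<bar>)" by simp
  finally show ?thesis using i by (subst (asm) mult_le_cancel_left_pos) auto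
qed

section \<open>Rademacher sums\<close>

text \<open>The set \<open>T\<close> of plus signs encodes the random signs. Expectations appear as
  sums over \<open>Pow I\<close>, hence the factors \<open>2 ^ card I\<close> below.\<close>

definition rademacher_sum :: "('i \<Rightarrow> real) \<Rightarrow> 'i set \<Rightarrow> 'i set \<Rightarrow> real" where
  "rademacher_sum d I T = (\<Sum>i\<in>I. if i \<in> T then d i else - d i)"

lemma sum_Pow_insert:
  fixes f :: "'i set \<Rightarrow> real"
  assumes "finite I" "x \<notin> I"
  shows "(\<Sum>T\<in>Pow (insert x I). f T) = (\<Sum>T\<in>Pow I. f T + f (insert x T))"
proof -
  have "Pow I \<inter> insert x ` Pow I = {}" using assms by auto
  moreover have "inj_on (insert x) (Pow I)"
    using assms by (auto simp: inj_on_def)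
  ultimately show ?thesis
    using assms by (simp add: Pow_insert sum.union_disjoint sum.reindex sum.distrib)
qed

lemma rademacher_sum_insert:
  assumes "finite I" "x \<notin> I" "T \<subseteq> I"
  shows "rademacher_sum d (insert x I) T = rademacher_sum d I T - d x"
    and "rademacher_sum d (insert x I) (insert x T) = rademacher_sum d I T + d x"
proof -
  have "x \<notin> T" using assms by auto
  thus "rademacher_sum d (insert x I) T = rademacher_sum d I T - d x"
    using assms by (simp add: rademacher_sum_def)
  have "(\<Sum>i\<in>I. if i = x \<or> i \<in> T then d i else - d i) = (\<Sum>i\<in>I. if i \<in> T then d i else - d i)"
    using assms by (intro sum.cong) auto
  thus "rademacher_sum d (insert x I) (insert x T) = rademacher_sum d I T + d x"
    using assms by (simp add: rademacher_sum_def)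
qed

text \<open>Pairing \<open>T\<close> with \<open>insert x T\<close> cancels the cross terms: (X -
  d)^2 + (X + d)^2 = 2X^2 + 2d^2.\<close>

lemma sum_rademacher_sum_power2:
  assumes "finite I"
  shows "(\<Sum>T\<in>Pow I. (rademacher_sum d I T)\<^sup>2) = 2 ^ card I * (\<Sum>i\<in>I. (d i)\<^sup>2)"
  using assms
proof (induction I)
  case empty
  show ?case by (simp add: rademacher_sum_def)
next
  case (insert x I)
  have "(\<Sum>T\<in>Pow (insert x I). (rademacher_sum d (insert x I) T)\<^sup>2) =
        (\<Sum>T\<in>Pow I. 2 * (rademacher_sum d I T)\<^sup>2 + 2 * (d x)\<^sup>2)"
    unfolding sum_Pow_insert[OF insert.hyps]
    by (intro sum.cong)
       (auto simp: rademacher_sum_insert[OF insert.hyps] power2_eq_square algebra_simps)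
  also have "\<dots> = 2 ^ card (insert x I) * (\<Sum>i\<in>insert x I. (d i)\<^sup>2)"
    using insert by (simp add: sum.distrib sum_distrib_left[symmetric] card_Pow algebra_simps)
  finally show ?case .
qed

text \<open>The same pairing removes the odd powers of \<open>d x\<close>; the surviving mixed term
  is evaluated by the second moment. The 3 is the fourth moment of a standard Gaussian.\<close>

lemma sum_rademacher_sum_power4_le:
  assumes "finite I"
  shows "(\<Sum>T\<in>Pow I. (rademacher_sum d I T) ^ 4) \<le> 2 ^ card I * (3 * (\<Sum>i\<in>I. (d i)\<^sup>2)\<^sup>2)"
  using assms
proof (induction I)
  case empty
  show ?case by (simp add: rademacher_sum_def)
next
  case (insert x I)
  let ?X = "rademacher_sum d I" and ?s = "\<Sum>i\<in>I. (d i)\<^sup>2"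
  have "(\<Sum>T\<in>Pow (insert x I). (rademacher_sum d (insert x I) T) ^ 4) =
        (\<Sum>T\<in>Pow I. 2 * ?X T ^ 4 + 12 * (d x)\<^sup>2 * (?X T)\<^sup>2 + 2 * (d x) ^ 4)"
    unfolding sum_Pow_insert[OF insert.hyps]
    by (intro sum.cong)
       (auto simp: rademacher_sum_insert[OF insert.hyps] power2_eq_square power4_eq_xxxx algebra_simps)
  also have "\<dots> = 2 * (\<Sum>T\<in>Pow I. ?X T ^ 4) + 12 * (d x)\<^sup>2 * (2 ^ card I * ?s) + 2 ^ card I * (2 * (d x) ^ 4)"
    using insert.hyps sum_rademacher_sum_power2[OF insert.hyps(1), of d]
    by (simp add: sum.distrib sum_distrib_left[symmetric] card_Pow)
  \<comment> \<open>The coefficient 2 of the fourth power of \<open>d x\<close> is raised to 6 to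
    complete the square in the next line.\<close>
  also have "\<dots> \<le> 2 * (2 ^ card I * (3 * ?s\<^sup>2)) + 12 * (d x)\<^sup>2 * (2 ^ card I * ?s) + 2 ^ card I * (6 * (d x) ^ 4)"
    using insert.IH by (intro add_mono mult_left_mono) auto
  also have "\<dots> = 2 ^ card (insert x I) * (3 * ((d x)\<^sup>2 + ?s)\<^sup>2)"
    using insert.hyps by (simp add: power2_eq_square power4_eq_xxxx algebra_simps)
  finally show ?case using insert.hyps by simp
qed

text \<open>Khintchine's inequality by fourth moments: \<open>2\<bar>t\<bar> \<ge> 3t\<^sup>2 - t\<^sup>4\<close>, because the difference
  factors as \<open>\<bar>t\<bar> (\<bar>t\<bar> - 1)\<^sup>2 (\<bar>t\<bar> + 2)\<close>; apply this to \<open>t = X / (2\<sigma>)\<close> with \<open>\<sigma>\<^sup>2\<close> the variance of \<open>X\<close>.\<close>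

lemma khintchine_lower:
  assumes "finite I"
  shows "2 ^ card I * (sqrt (\<Sum>i\<in>I. (d i)\<^sup>2) / 2) \<le> (\<Sum>T\<in>Pow I. \<bar>rademacher_sum d I T\<bar>)"
proof (cases "(\<Sum>i\<in>I. (d i)\<^sup>2) = 0")
  case True
  then show ?thesis by (simp add: sum_nonneg)
next
  case False
  let ?X = "rademacher_sum d I" and ?N = "2 ^ card I :: real"
  define s where "s = sqrt (\<Sum>i\<in>I. (d i)\<^sup>2)"
  have s2: "s\<^sup>2 = (\<Sum>i\<in>I. (d i)\<^sup>2)" by (simp add: s_def sum_nonneg)
  have s: "s > 0"
    using False by (auto simp: s_def sum_nonneg less_le)
  have ineq: "\<bar>x\<bar> \<ge> 3 * x\<^sup>2 / (4 * s) - x ^ 4 / (16 * s ^ 3)" for x :: real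
  proof -
    define t where "t = \<bar>x\<bar> / (2 * s)"
    have "t * (t - 1)\<^sup>2 * (t + 2) \<ge> 0" using s by (simp add: t_def)
    hence "2 * t \<ge> 3 * t\<^sup>2 - t ^ 4"
      by (simp add: power2_eq_square power4_eq_xxxx algebra_simps)
    hence "s * (2 * t) \<ge> s * (3 * t\<^sup>2 - t ^ 4)"
      using s by (intro mult_left_mono) auto
    moreover have "s * (2 * t) = \<bar>x\<bar>" using s by (simp add: t_def)
    moreover have "s * (3 * t\<^sup>2 - t ^ 4) = 3 * x\<^sup>2 / (4 * s) - x ^ 4 / (16 * s ^ 3)"
      using s by (simp add: t_def power_divide power_mult_distrib field_simps
          power2_eq_square power3_eq_cube power4_eq_xxxx)
    ultimately show ?thesis by simp
  qed
  \<comment> \<open>The two moments contribute 3/4 - 3/16 = 9/16, which is rounded down to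
    1/2.\<close>
  have "?N * (s / 2) \<le> ?N * (9 / 16 * s)" using s by simp
  also have "\<dots> = 3 / (4 * s) * (?N * s\<^sup>2) - (?N * (3 * (s\<^sup>2)\<^sup>2)) / (16 * s ^ 3)"
    using s by (simp add: field_simps power2_eq_square power3_eq_cube)
  also have "\<dots> \<le> 3 / (4 * s) * (\<Sum>T\<in>Pow I. (?X T)\<^sup>2) - (\<Sum>T\<in>Pow I. ?X T ^ 4) / (16 * s ^ 3)"
    unfolding s2 sum_rademacher_sum_power2[OF assms]
    using s sum_rademacher_sum_power4_le[OF assms, of d]
    by (intro diff_left_mono divide_right_mono) auto
  also have "\<dots> = (\<Sum>T\<in>Pow I. 3 * (?X T)\<^sup>2 / (4 * s) - ?X T ^ 4 / (16 * s ^ 3))"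
    by (simp add: sum_subtractf sum_distrib_left sum_divide_distrib)
  also have "\<dots> \<le> (\<Sum>T\<in>Pow I. \<bar>?X T\<bar>)" by (intro sum_mono ineq)
  finally show ?thesis by (simp add: s_def)
qed

text \<open>Complementing \<open>T\<close> flips the sign of the sum, so the values pair up as
  \<bar>b + X\<bar> + \<bar>b - X\<bar> \<ge> 2\<bar>X\<bar>: a shift cannot lower the mean absolute
  value of a symmetric variable.\<close>

lemma sum_abs_add_rademacher_sum:
  assumes "finite I"
  shows "(\<Sum>T\<in>Pow I. \<bar>rademacher_sum d I T\<bar>) \<le> (\<Sum>T\<in>Pow I. \<bar>b + rademacher_sum d I T\<bar>)"
proof -
  let ?X = "rademacher_sum d I"
  have neg: "?X (I - T) = - ?X T" for T
    unfolding rademacher_sum_def sum_negf[symmetric] by (intro sum.cong) auto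
  have "bij_betw (\<lambda>T. I - T) (Pow I) (Pow I)"
    by (rule bij_betw_byWitness[where f' = "\<lambda>T. I - T"]) auto
  from sum.reindex_bij_betw[OF this, of "\<lambda>T. \<bar>b + ?X T\<bar>"]
  have "2 * (\<Sum>T\<in>Pow I. \<bar>b + ?X T\<bar>) = (\<Sum>T\<in>Pow I. \<bar>b + ?X T\<bar> + \<bar>b - ?X T\<bar>)"
    by (simp add: neg sum.distrib)
  also have "\<dots> \<ge> (\<Sum>T\<in>Pow I. 2 * \<bar>?X T\<bar>)" by (intro sum_mono) linarith
  finally show ?thesis by (simp add: sum_distrib_left[symmetric])
qed

text \<open>Choosing \<open>x i\<close> or \<open>y i\<close> means adding plus or minus half their
  difference to their midpoint. The midpoints form a shift, and Khintchine bounds the rest; the 4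
  combines its factor 1/2 with that of the half differences.\<close>

lemma sum_abs_choice_ge:
  fixes x y :: "'i \<Rightarrow> real"
  assumes "finite I"
  shows "2 ^ card I * ((\<Sum>i\<in>I. \<bar>x i - y i\<bar>) / 4) \<le>
         sqrt (card I) * (\<Sum>T\<in>Pow I. \<bar>\<Sum>i\<in>I. if i \<in> T then y i else x i\<bar>)"
proof -
  define d where "d = (\<lambda>i. (y i - x i) / 2)"
  let ?b = "\<Sum>i\<in>I. (x i + y i) / 2"
  have split: "(\<Sum>i\<in>I. if i \<in> T then y i else x i) = ?b + rademacher_sum d I T" for T
    unfolding rademacher_sum_def sum.distrib[symmetric]
    by (intro sum.cong) (auto simp: d_def field_simps)
  \<comment> \<open>Cauchy-Schwarz passes from the Euclidean norm in Khintchine's inequality to the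
    sum of absolute values, at the cost of \<open>sqrt (card I)\<close>.\<close>
  have "(\<Sum>i\<in>I. \<bar>d i\<bar>)\<^sup>2 \<le> card I * (\<Sum>i\<in>I. \<bar>d i\<bar>\<^sup>2)"
    using sum_squared_le_sum_of_squares[of "\<lambda>i. \<bar>d i\<bar>" I] by (simp only: mult.commute)
  hence "sqrt ((\<Sum>i\<in>I. \<bar>d i\<bar>)\<^sup>2) \<le> sqrt (card I * (\<Sum>i\<in>I. (d i)\<^sup>2))"
    by (intro real_sqrt_le_mono) simp
  hence "(\<Sum>i\<in>I. \<bar>d i\<bar>) \<le> sqrt (card I) * sqrt (\<Sum>i\<in>I. (d i)\<^sup>2)"
    by (simp add: real_sqrt_mult sum_nonneg)
  hence "2 ^ card I * ((\<Sum>i\<in>I. \<bar>d i\<bar>) / 2) \<le>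
      sqrt (card I) * (2 ^ card I * (sqrt (\<Sum>i\<in>I. (d i)\<^sup>2) / 2))"
    by simp
  also have "\<dots> \<le> sqrt (card I) * (\<Sum>T\<in>Pow I. \<bar>?b + rademacher_sum d I T\<bar>)"
    using khintchine_lower[OF assms, of d] sum_abs_add_rademacher_sum[OF assms, of d ?b]
    by (intro mult_left_mono) auto
  also have "(\<Sum>i\<in>I. \<bar>d i\<bar>) = (\<Sum>i\<in>I. \<bar>x i - y i\<bar>) / 2"
    unfolding sum_divide_distrib by (intro sum.cong) (auto simp: d_def)
  finally show ?thesis by (simp add: split)
qed

section \<open>Lower bound\<close>

definition block_swap :: "nat \<Rightarrow> nat set \<Rightarrow> nat \<Rightarrow> nat" where
  "block_swap m T i =
    (if i < m \<and> i \<in> T then m + i else if m \<le> i \<and> i < 2 * m \<and> i - m \<in> T then i - m else i)"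

text \<open>The map is an involution and hence serves as its own inverse;
  \<open>2 * m \<le> n\<close> keeps both blocks inside the range.\<close>

lemma block_swap_permutes:
  assumes "2 * m \<le> n"
  shows "block_swap m T permutes {..<n}"
proof (rule bij_imp_permutes)
  show "bij_betw (block_swap m T) {..<n} {..<n}"
    by (rule bij_betw_byWitness[where f' = "block_swap m T"])
       (use assms in \<open>auto simp: block_swap_def\<close>)
qed (use assms in \<open>auto simp: block_swap_def\<close>)

lemma sum_list_take_nth:
  fixes A :: "real list"
  assumes "m \<le> length A"
  shows "sum_list (take m A) = (\<Sum>i<m. A ! i)"
  using assms by (simp add: sum_list_sum_nth atLeast0LessThan min_absorb2)

lemma expectation_abs_prefix_ge:
  fixes M :: "real list"
  assumes sum0: "sum_list M = 0" and m: "2 * m \<le> length M" and "m > 0"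
  shows "average_abs M * sqrt m / 4 \<le>
         measure_pmf.expectation (random_order M) (\<lambda>A. \<bar>sum_list (take m A)\<bar>)"
proof -
  let ?E = "measure_pmf.expectation (random_order M)"
  let ?I = "{..<m}"
  \<comment> \<open>Every choice set \<open>T\<close> yields the same expectation, so summing over
    \<open>T\<close> merely multiplies it by \<open>2 ^ m\<close>.\<close>
  have inv: "?E (\<lambda>A. \<bar>\<Sum>i<m. if i \<in> T then A ! (m + i) else A ! i\<bar>) = ?E (\<lambda>A. \<bar>sum_list (take m A)\<bar>)"
    for T
  proof -
    have perm: "block_swap m T permutes {..<length M}" by (rule block_swap_permutes[OF m])
    have "?E (\<lambda>A. \<bar>\<Sum>i<m. if i \<in> T then A ! (m + i) else A ! i\<bar>) =
          ?E (\<lambda>A. \<bar>sum_list (take m (permute_list (block_swap m T) A))\<bar>)"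
    proof (rule expectation_cong_random_order)
      fix A assume "A \<in> set_pmf (random_order M)"
      hence len: "length A = length M" by (rule length_random_order)
      have "sum_list (take m (permute_list (block_swap m T) A)) =
            (\<Sum>i<m. permute_list (block_swap m T) A ! i)"
        using m len by (intro sum_list_take_nth) simp
      also have "\<dots> = (\<Sum>i<m. if i \<in> T then A ! (m + i) else A ! i)"
        using m len perm by (intro sum.cong) (auto simp: permute_list_nth block_swap_def)
      finally show "\<bar>\<Sum>i<m. if i \<in> T then A ! (m + i) else A ! i\<bar> =
            \<bar>sum_list (take m (permute_list (block_swap m T) A))\<bar>" by simp
    qed
    thus ?thesis using expectation_permute_list[OF perm, of "\<lambda>A. \<bar>sum_list (take m A)\<bar>"] by simp
  qed
  have "2 ^ m * (m * average_abs M / 4) = 2 ^ m * ((\<Sum>i<m. average_abs M) / 4)" by simp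
  also have "\<dots> \<le> 2 ^ m * ((\<Sum>i<m. ?E (\<lambda>A. \<bar>A ! i - A ! (m + i)\<bar>)) / 4)"
    using m \<open>m > 0\<close>
    by (intro mult_left_mono divide_right_mono sum_mono expectation_abs_diff_nth[OF sum0]) auto
  also have "\<dots> = ?E (\<lambda>A. 2 ^ card ?I * ((\<Sum>i\<in>?I. \<bar>A ! i - A ! (m + i)\<bar>) / 4))" by simp
  also have "\<dots> \<le> ?E (\<lambda>A. sqrt (card ?I) * (\<Sum>T\<in>Pow ?I. \<bar>\<Sum>i\<in>?I. if i \<in> T then A ! (m + i) else A ! i\<bar>))"
    by (intro expectation_mono_random_order sum_abs_choice_ge) simp
  also have "\<dots> = 2 ^ m * (sqrt m * ?E (\<lambda>A. \<bar>sum_list (take m A)\<bar>))"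
    by (simp add: inv card_Pow)
  finally have "m * average_abs M / 4 \<le> sqrt m * ?E (\<lambda>A. \<bar>sum_list (take m A)\<bar>)" by simp
  \<comment> \<open>Writing \<open>m\<close> as the square of its root lets one factor
    \<open>sqrt m\<close> cancel.\<close>
  moreover have "m * average_abs M / 4 = sqrt m * (average_abs M * sqrt m / 4)"
    by (simp flip: real_sqrt_mult_self[of "real m"])
  ultimately show ?thesis using \<open>m > 0\<close> by simp
qed

section \<open>Deciding once, at half time\<close>

definition halfway_algorithm :: stopping_algorithm where
  "halfway_algorithm n xs \<longleftrightarrow> length xs = n div 2 \<and> sum_list xs < 0"

text \<open>As the total is 0, stopping at half time pays \<open>- X\<close> and running to the end
  pays 0. The payoff is thus the negative part of \<open>X\<close>.\<close>

lemma payoff_halfway_algorithm: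
  assumes "sum_list A = 0"
  defines "X \<equiv> sum_list (take (length A div 2) A)"
  shows "payoff halfway_algorithm A = (\<bar>X\<bar> - X) / 2"
proof -
  let ?m = "length A div 2"
  \<comment> \<open>The bound on \<open>i\<close> ensures that the prefix has length exactly
    \<open>i\<close>. The least index in \<open>stopping_time\<close> ranges over all naturals,
    hence the case distinctions below.\<close>
  have iff: "halfway_algorithm (length A) (take i A) \<longleftrightarrow> i = ?m \<and> X < 0" if "i \<le> length A" for i
    using that by (auto simp: halfway_algorithm_def X_def)
  have split: "sum_list (take ?m A) + sum_list (drop ?m A) = 0"
    using assms(1) by (metis append_take_drop_id sum_list_append)
  show ?thesis
  proof (cases "X < 0")
    case True
    have "stopping_time halfway_algorithm A = ?m"
      unfolding stopping_time_def
    proof (rule Least_equality)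
      show "?m = length A \<or> halfway_algorithm (length A) (take ?m A)" using True iff by auto
    next
      fix i assume "i = length A \<or> halfway_algorithm (length A) (take i A)"
      thus "?m \<le> i" using iff[of i] by (cases "i \<le> length A") auto
    qed
    thus ?thesis using True split by (simp add: payoff_def X_def)
  next
    case False
    have "stopping_time halfway_algorithm A = length A"
      unfolding stopping_time_def
    proof (rule Least_equality)
      fix i assume "i = length A \<or> halfway_algorithm (length A) (take i A)"
      thus "length A \<le> i" using iff[of i] False by (cases "i \<le> length A") auto
    qed simp
    thus ?thesis using False by (simp add: payoff_def)
  qed
qed

text \<open>Each entry has mean 0, so the linear term of the negative part vanishes in
  expectation.\<close>

lemma expected_payoff_halfway_algorithm:
  assumes "sum_list M = 0"
  shows "expected_payoff halfway_algorithm M =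
         measure_pmf.expectation (random_order M) (\<lambda>A. \<bar>sum_list (take (length M div 2) A)\<bar>) / 2"
proof -
  let ?E = "measure_pmf.expectation (random_order M)" and ?m = "length M div 2"
  have sum0: "sum_list A = 0" if "A \<in> set_pmf (random_order M)" for A
    using mset_random_order[OF that] assms by (metis sum_mset_sum_list)
  have "?E (\<lambda>A. sum_list (take ?m A)) = ?E (\<lambda>A. \<Sum>i<?m. A ! i)"
    by (intro expectation_cong_random_order sum_list_take_nth) (simp add: length_random_order)
  also have "\<dots> = (\<Sum>i<?m. ?E (\<lambda>A. A ! i))" by simp
  also have "\<dots> = 0"
    using assms expectation_nth[of _ M "\<lambda>x. x"] by simp
  finally have mean: "?E (\<lambda>A. sum_list (take ?m A)) = 0" .
  have "expected_payoff halfway_algorithm M =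
      ?E (\<lambda>A. (\<bar>sum_list (take ?m A)\<bar> - sum_list (take ?m A)) / 2)"
    unfolding expected_payoff_def
    by (intro expectation_cong_random_order)
       (simp add: payoff_halfway_algorithm sum0 length_random_order)
  also have "\<dots> = ?E (\<lambda>A. \<bar>sum_list (take ?m A)\<bar>) / 2" by (simp add: mean)
  finally show ?thesis .
qed

text \<open>The constant is 1/4 from the prefix bound, 1/2 from the negative part and 1/2 from
  \<open>length M \<le> 4 * m\<close>. That last estimate fails for one element, but this element is
  then 0.\<close>

lemma expected_payoff_halfway_algorithm_ge:
  assumes "sum_list M = 0" "M \<noteq> []"
  shows "1 / 16 * average_abs M * sqrt (length M) \<le> expected_payoff halfway_algorithm M"
proof (cases "length M = 1")
  case True
  then obtain a where "M = [a]" by (auto simp: length_Suc_conv)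
  hence "average_abs M = 0" using assms by (simp add: average_abs_def)
  thus ?thesis by (simp add: expected_payoff_halfway_algorithm[OF assms(1)])
next
  case False
  define m where "m = length M div 2"
  have len: "length M \<ge> 2" using False assms(2) by (cases M) (auto simp: Suc_le_eq)
  hence m: "m > 0" "2 * m \<le> length M" "length M \<le> 4 * m" by (auto simp: m_def)
  have "sqrt (length M) \<le> sqrt (4 * m)" using m(3) by (intro real_sqrt_le_mono) linarith
  hence "sqrt (length M) \<le> 2 * sqrt m" by (simp add: real_sqrt_mult)
  moreover have "average_abs M \<ge> 0"
    by (auto simp: average_abs_def intro!: divide_nonneg_nonneg sum_list_nonneg)
  ultimately have "average_abs M * sqrt (length M) \<le> average_abs M * (2 * sqrt m)"
    by (intro mult_left_mono)
  thus ?thesis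
    using expectation_abs_prefix_ge[OF assms(1) m(2,1)]
    by (simp add: expected_payoff_halfway_algorithm[OF assms(1)] m_def)
qed

section \<open>Upper bound\<close>

lemma stopping_time_le: "stopping_time S A \<le> length A"
  unfolding stopping_time_def by (rule Least_le) simp

text \<open>This shows that still running after \<open>k\<close> elements is an event determined by
  the length and the first \<open>k\<close> elements alone.\<close>

lemma less_stopping_time_iff:
  "k < stopping_time S A \<longleftrightarrow> k < length A \<and> (\<forall>i\<le>k. \<not> S (length A) (take i A))"
proof -
  let ?Q = "\<lambda>i. i = length A \<or> S (length A) (take i A)"
  have Q: "?Q (stopping_time S A)"
    unfolding stopping_time_def by (rule LeastI[of ?Q "length A"]) simp
  have not_Q: "\<not> ?Q i" if "i < stopping_time S A" for i
    using that not_less_Least[of i ?Q] unfolding stopping_time_def by blast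
  show ?thesis
  proof
    assume "k < stopping_time S A"
    thus "k < length A \<and> (\<forall>i\<le>k. \<not> S (length A) (take i A))"
      using not_Q stopping_time_le[of S A] by (meson le_less_trans less_le_trans)
  next
    assume k: "k < length A \<and> (\<forall>i\<le>k. \<not> S (length A) (take i A))"
    show "k < stopping_time S A"
    proof (rule ccontr)
      assume "\<not> k < stopping_time S A"
      hence "stopping_time S A \<le> k" by simp
      with Q k show False by auto
    qed
  qed
qed

lemma sum_list_drop_nth:
  fixes A :: "real list"
  assumes "k \<le> length A"
  shows "sum_list (drop k A) = (\<Sum>i=k..<length A. A ! i)"
proof -
  have "sum_list (drop k A) = (\<Sum>i=0..<length A - k. A ! (i + k))"
    using assms by (simp add: sum_list_sum_nth add.commute)
  also have "\<dots> = (\<Sum>i=k..<length A. A ! i)"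
    using assms sum.shift_bounds_nat_ivl[of "\<lambda>i. A ! i" 0 k "length A - k"] by simp
  finally show ?thesis .
qed

text \<open>Whether \<open>S\<close> is still running and \<open>R\<^sub>k\<close> are unchanged when the elements \<open>k\<close> and \<open>j \<ge> k\<close> are
  transposed, so the next element may be replaced by the average of the unrevealed ones.\<close>

lemma expectation_suffix_times_next_nonneg:
  fixes M :: "real list"
  assumes k: "k < length M"
  shows "measure_pmf.expectation (random_order M)
           (\<lambda>A. of_bool (k < stopping_time S A) * (sum_list (drop k A) * A ! k)) \<ge> 0"
proof -
  let ?E = "measure_pmf.expectation (random_order M)" and ?n = "length M"
  define F where "F = (\<lambda>A. of_bool (k < stopping_time S A) * sum_list (drop k A))"
  have F_transpose: "F (permute_list (Transposition.transpose k j) A) = F A"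
    if "k \<le> j" "j < length A" for j A
  proof -
    let ?B = "permute_list (Transposition.transpose k j) A"
    \<comment> \<open>The transposition only rearranges unrevealed positions, so it changes neither
      the prefixes of length at most \<open>k\<close> nor the unrevealed sum.\<close>
    have perm: "Transposition.transpose k j permutes {k..<length A}"
      using that by (intro permutes_swap_id) auto
    have nth: "?B ! i = A ! Transposition.transpose k j i" if "i < length A" for i
      using that \<open>k \<le> j\<close> \<open>j < length A\<close> by (simp add: nth_permute_transpose)
    have "take i ?B = take i A" if "i \<le> k" for i
      using that \<open>k \<le> j\<close> \<open>j < length A\<close> by (intro nth_equalityI) (auto simp: nth Transposition.transpose_def)
    hence "k < stopping_time S ?B \<longleftrightarrow> k < stopping_time S A"
      by (simp add: less_stopping_time_iff)
    moreover have "sum_list (drop k ?B) = sum_list (drop k A)"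
      using sum.permute[OF perm, of "\<lambda>i. A ! i"] that by (simp add: sum_list_drop_nth nth o_def)
    ultimately show ?thesis by (simp add: F_def)
  qed
  have eq: "?E (\<lambda>A. F A * A ! j) = ?E (\<lambda>A. F A * A ! k)" if "j \<in> {k..<?n}" for j
  proof -
    have "?E (\<lambda>A. F A * A ! j) =
        ?E (\<lambda>A. F (permute_list (Transposition.transpose k j) A) * permute_list (Transposition.transpose k j) A ! k)"
      using that k
      by (intro expectation_cong_random_order)
         (simp add: F_transpose nth_permute_transpose length_random_order)
    also have "\<dots> = ?E (\<lambda>A. F A * A ! k)"
      using that k
      by (intro expectation_permute_list[where f = "\<lambda>A. F A * A ! k"]) (auto intro: permutes_swap_id)
    finally show ?thesis .
  qed
  \<comment> \<open>The integrand is an indicator times a square. Expanding one factor over the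
    unrevealed positions gives \<open>n - k\<close> terms of equal expectation.\<close>
  have "0 \<le> ?E (\<lambda>A. F A * sum_list (drop k A))"
    by (intro Bochner_Integration.integral_nonneg) (simp add: F_def)
  also have "\<dots> = ?E (\<lambda>A. \<Sum>j=k..<?n. F A * A ! j)"
    using k by (intro expectation_cong_random_order)
       (simp add: sum_list_drop_nth length_random_order sum_distrib_left)
  also have "\<dots> = (\<Sum>j=k..<?n. ?E (\<lambda>A. F A * A ! j))" by simp
  also have "\<dots> = (\<Sum>j=k..<?n. ?E (\<lambda>A. F A * A ! k))" by (rule sum.cong[OF refl eq])
  also have "\<dots> = real (?n - k) * ?E (\<lambda>A. F A * A ! k)" by simp
  finally have "0 \<le> ?E (\<lambda>A. F A * A ! k)"
    using k by (simp add: zero_le_mult_iff)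
  thus ?thesis unfolding F_def mult.assoc .
qed

text \<open>The unrevealed sum starts at 0 and loses \<open>A ! k\<close> at step \<open>k\<close>,
  so its squares telescope up to the stopping time. The indicator replaces the random range of
  summation by a fixed one, as needed for taking expectations.\<close>

lemma payoff_power2_telescope:
  assumes "sum_list A = 0"
  shows "(payoff S A)\<^sup>2 = (\<Sum>k<length A. of_bool (k < stopping_time S A) *
           ((A ! k)\<^sup>2 - 2 * (sum_list (drop k A) * A ! k)))"
proof -
  let ?R = "\<lambda>k. sum_list (drop k A)" and ?\<tau> = "stopping_time S A"
  have "(payoff S A)\<^sup>2 = (\<Sum>k<?\<tau>. (?R (Suc k))\<^sup>2 - (?R k)\<^sup>2)"
    using assms by (subst sum_lessThan_telescope) (simp add: payoff_def)
  also have "\<dots> = (\<Sum>k<?\<tau>. (A ! k)\<^sup>2 - 2 * (?R k * A ! k))"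
  proof (rule sum.cong)
    fix k assume "k \<in> {..<?\<tau>}"
    hence "k < length A" using stopping_time_le[of S A] by simp
    from Cons_nth_drop_Suc[OF this, symmetric] have "?R k = A ! k + ?R (Suc k)" by simp
    hence R: "?R (Suc k) = ?R k - A ! k" by simp
    show "(?R (Suc k))\<^sup>2 - (?R k)\<^sup>2 = (A ! k)\<^sup>2 - 2 * (?R k * A ! k)"
      unfolding R by (simp add: power2_eq_square algebra_simps)
  qed simp
  also have "\<dots> = (\<Sum>k<length A. of_bool (k < ?\<tau>) * ((A ! k)\<^sup>2 - 2 * (?R k * A ! k)))"
    using stopping_time_le[of S A] by (intro sum.mono_neutral_cong_left) auto
  finally show ?thesis .
qed

lemma expectation_payoff_power2_le:
  assumes "sum_list M = 0"
  shows "measure_pmf.expectation (random_order M) (\<lambda>A. (payoff S A)\<^sup>2) \<le> (\<Sum>a\<leftarrow>M. a\<^sup>2)"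
proof -
  let ?E = "measure_pmf.expectation (random_order M)" and ?n = "length M"
  let ?G = "\<lambda>k A. of_bool (k < stopping_time S A) * (sum_list (drop k A) * A ! k)"
  have "?E (\<lambda>A. (payoff S A)\<^sup>2) \<le> ?E (\<lambda>A. (\<Sum>a\<leftarrow>M. a\<^sup>2) - (\<Sum>k<?n. 2 * ?G k A))"
  proof (rule expectation_mono_random_order)
    fix A assume A: "A \<in> set_pmf (random_order M)"
    have len: "length A = ?n" using A by (rule length_random_order)
    have "sum_list A = 0"
      using mset_random_order[OF A] assms by (metis sum_mset_sum_list)
    hence "(payoff S A)\<^sup>2 = (\<Sum>k<?n. of_bool (k < stopping_time S A) *
           ((A ! k)\<^sup>2 - 2 * (sum_list (drop k A) * A ! k)))"
      using payoff_power2_telescope[of A S] len by simp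
    \<comment> \<open>The indicator is dropped from the squares only; the cross terms keep it, since
      their expectation is controlled only up to the stopping time.\<close>
    also have "\<dots> \<le> (\<Sum>k<?n. (A ! k)\<^sup>2 - 2 * ?G k A)"
      by (intro sum_mono) (auto simp: of_bool_def)
    also have "\<dots> = (\<Sum>a\<leftarrow>M. a\<^sup>2) - (\<Sum>k<?n. 2 * ?G k A)"
      using sum_nth_random_order[OF A, of "\<lambda>x. x\<^sup>2"] by (simp add: sum_subtractf)
    finally show "(payoff S A)\<^sup>2 \<le> (\<Sum>a\<leftarrow>M. a\<^sup>2) - (\<Sum>k<?n. 2 * ?G k A)" .
  qed
  also have "\<dots> = (\<Sum>a\<leftarrow>M. a\<^sup>2) - (\<Sum>k<?n. 2 * ?E (?G k))" by simp
  also have "\<dots> \<le> (\<Sum>a\<leftarrow>M. a\<^sup>2)"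
    using sum_nonneg[of "{..<?n}" "\<lambda>k. 2 * ?E (?G k)"] expectation_suffix_times_next_nonneg[of _ M S]
    by simp
  finally show ?thesis .
qed

text \<open>Nonnegativity of the variance bounds the squared mean by the second moment.\<close>

lemma expected_payoff_le:
  assumes "sum_list M = 0"
  shows "expected_payoff S M \<le> sqrt (\<Sum>a\<leftarrow>M. a\<^sup>2)"
proof -
  have "0 \<le> measure_pmf.variance (random_order M) (payoff S)"
    by (rule measure_pmf.variance_positive)
  also have "\<dots> = measure_pmf.expectation (random_order M) (\<lambda>A. (payoff S A)\<^sup>2) -
      (expected_payoff S M)\<^sup>2"
    unfolding expected_payoff_def by (rule measure_pmf.variance_eq) simp_all
  finally have "(expected_payoff S M)\<^sup>2 \<le> (\<Sum>a\<leftarrow>M. a\<^sup>2)"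
    using expectation_payoff_power2_le[OF assms, of S] by simp
  thus ?thesis by (rule real_le_rsqrt)
qed

lemma expected_payoff_balanced_le:
  assumes "even n" "\<mu> > 0"
    and M: "mset M = replicate_mset (n div 2) \<mu> + replicate_mset (n div 2) (- \<mu>)"
  shows "expected_payoff S M \<le> \<mu> * sqrt n"
proof -
  have "sum_list M = sum_mset (mset M)" by (simp add: sum_mset_sum_list)
  also have "\<dots> = 0" by (simp add: M)
  finally have sum0: "sum_list M = 0" .
  have "(\<Sum>a\<leftarrow>M. a\<^sup>2) = (\<Sum>a\<in>#mset M. a\<^sup>2)" by (metis mset_map sum_mset_sum_list)
  also have "\<dots> = 2 * real (n div 2) * \<mu>\<^sup>2" by (simp add: M)
  also have "\<dots> = n * \<mu>\<^sup>2" using \<open>even n\<close> by (simp add: real_of_nat_div)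
  finally have "(\<Sum>a\<leftarrow>M. a\<^sup>2) = n * \<mu>\<^sup>2" .
  thus ?thesis using expected_payoff_le[OF sum0, of S] \<open>\<mu> > 0\<close>
    by (simp add: real_sqrt_mult mult.commute)
qed

theorem theorem1:
  "(\<exists>c::real. c > 0 \<and>
      (\<exists>S::stopping_algorithm. \<forall>n::nat. \<forall>M::real list.
         n \<ge> 1 \<longrightarrow> length M = n \<longrightarrow> sum_list M = 0 \<longrightarrow>
           expected_payoff S M \<ge> c * average_abs M * sqrt (real n)))
   \<and>
   (\<exists>C::real. C > 0 \<and>
      (\<forall>n::nat. \<forall>\<mu>::real. \<forall>M::real list. \<forall>S::stopping_algorithm.
         even n \<longrightarrow> \<mu> > 0 \<longrightarrow>
         mset M = replicate_mset (n div 2) \<mu> + replicate_mset (n div 2) (- \<mu>) \<longrightarrow>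
           expected_payoff S M \<le> C * \<mu> * sqrt (real n)))"
proof (rule conjI)
  have "1 / 16 * average_abs M * sqrt (real n) \<le> expected_payoff halfway_algorithm M"
    if "n \<ge> 1" "length M = n" "sum_list M = 0" for n and M :: "real list"
    using that expected_payoff_halfway_algorithm_ge[of M] by (cases "M = []") auto
  thus "\<exists>c::real. c > 0 \<and>
      (\<exists>S::stopping_algorithm. \<forall>n::nat. \<forall>M::real list.
         n \<ge> 1 \<longrightarrow> length M = n \<longrightarrow> sum_list M = 0 \<longrightarrow>
           expected_payoff S M \<ge> c * average_abs M * sqrt (real n))"
    by (intro exI[of _ "1 / 16"] exI[of _ halfway_algorithm] conjI allI impI) simp_all
next
  show "\<exists>C::real. C > 0 \<and>
      (\<forall>n::nat. \<forall>\<mu>::real. \<forall>M::real list. \<forall>S::stopping_algorithm.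
         even n \<longrightarrow> \<mu> > 0 \<longrightarrow>
         mset M = replicate_mset (n div 2) \<mu> + replicate_mset (n div 2) (- \<mu>) \<longrightarrow>
           expected_payoff S M \<le> C * \<mu> * sqrt (real n))"
    by (intro exI[of _ 1] conjI allI impI) (simp_all only: mult_1 expected_payoff_balanced_le zero_less_one)
qed

end
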